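(* There exists a connected cubic graph $G$ containing a $3$-cycle such that $G$ has no $2$-coupon coloring.
   Context: All graphs are finite and simple. A $k$-coloring of a graph $G$ is an assignment of colors from $\{0,\ldots,k-1\}$ to the vertices of $G$. For a graph $G$ without isolated vertices, a $k$-coupon coloring of $G$ is a $k$-coloring of $G$ such that for every vertex $v$ of $G$, the open neighborhood $N_G(v)$ (the set of vertices adjacent to $v$) contains vertices of all $k$ colors. A $3$-cycle is a cycle of length $3$ (a triangle). *)

theory Defs
  imports "Graph_Theory.Graph_Theory"
begin

text \<open>
  Finite simple graphs are the loop-free symmetric digraphs of the locale \<^locale>\<open>pair_graph\<close>:
  an edge \<open>uv\<close> is the pair of arcs \<open>(u, v)\<close> and \<open>(v, u)\<close>, so the degree of a vertex is its
  out-degree. A closed walk \<open>u, v, u\<close> counts as a cycle for \<^const>\<open>pre_digraph.cycle\<close>, but a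
  cycle with three arcs runs through three distinct vertices and is a triangle.
\<close>

definition cubic :: "'a pair_pre_digraph \<Rightarrow> bool" where
  "cubic G \<longleftrightarrow> (\<forall>v \<in> pverts G. out_degree (with_proj G) v = 3)"

definition contains_3_cycle :: "'a pair_pre_digraph \<Rightarrow> bool" where
  "contains_3_cycle G \<longleftrightarrow> (\<exists>p. pre_digraph.cycle (with_proj G) p \<and> length p = 3)"

definition open_neighborhood :: "'a pair_pre_digraph \<Rightarrow> 'a \<Rightarrow> 'a set" where
  "open_neighborhood G v = {u \<in> pverts G. (v, u) \<in> parcs G}"

text \<open>Colors of points outside the vertex set are irrelevant.\<close>

definition k_coloring :: "nat \<Rightarrow> 'a pair_pre_digraph \<Rightarrow> ('a \<Rightarrow> nat) \<Rightarrow> bool" where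
  "k_coloring k G c \<longleftrightarrow> (\<forall>v \<in> pverts G. c v \<in> {0..<k})"

definition coupon_coloring :: "nat \<Rightarrow> 'a pair_pre_digraph \<Rightarrow> ('a \<Rightarrow> nat) \<Rightarrow> bool" where
  "coupon_coloring k G c \<longleftrightarrow>
     k_coloring k G c \<and>
     (\<forall>v \<in> pverts G. \<forall>i \<in> {0..<k}. \<exists>u \<in> open_neighborhood G v. c u = i)"

end

theory Submission
  imports Defs
begin

text \<open>
  A hypergraph whose edges are the open neighborhoods of a cubic graph has to be shown not to be
  2-colorable. In the Heawood graph with an edge \<open>LP\<close> deleted and new edges \<open>uL\<close>, \<open>Pv\<close> attached,
  the fact that the Fano plane is not 2-colorable forces \<open>P\<close> to have the color opposite to \<open>u\<close>,
  and dually \<open>L\<close> the color opposite to \<open>v\<close>. So replacing an edge \<open>uv\<close> by such a gadget makes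
  \<open>u\<close> and \<open>v\<close> see each other with inverted colors. The triangular prism with two suitable edges
  inverted in this way (each of its three squares then has exactly one inverted edge) has no
  2-coupon coloring, and one of its triangles remains intact.
\<close>

lemma fano_negation:
  fixes p :: "nat \<Rightarrow> bool"
  assumes "\<forall>i \<in> {1, 2, 3, 4, 5, 6}. \<not> (p i = p ((i + 1) mod 7) \<and> p i = p ((i + 3) mod 7))"
    and "\<not> (w = p 1 \<and> w = p 3)"
  shows "p 0 \<longleftrightarrow> \<not> w"
  using assms by (simp add: numeral_2_eq_2) argo

text \<open>The lines are \<open>a + i\<close> and the points \<open>a + 7 + j\<close>, for \<open>i, j < 7\<close>.\<close>

definition heawood_gadget :: "nat \<Rightarrow> nat \<Rightarrow> nat \<Rightarrow> (nat \<times> nat) list" where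
  "heawood_gadget a u v = (u, a) # (a + 7, v) #
     remove1 (a, a + 7) [(a + i, a + 7 + (i + d) mod 7). i \<leftarrow> [0..<7], d \<leftarrow> [0, 1, 3]]"

text \<open>The prism has triangles 1, 2, 3 and 0, 4, 5 and rungs 0-1, 2-5, 3-4. Gadgets on 6 to 19
  and 20 to 33 replace the edges 0-4 and 2-5.\<close>

definition edges :: "(nat \<times> nat) list" where
  "edges = [(0, 1), (0, 5), (1, 2), (1, 3), (2, 3), (3, 4), (4, 5)]
     @ heawood_gadget 6 0 4 @ heawood_gadget 20 2 5"

definition nbrs :: "nat \<Rightarrow> nat list" where
  "nbrs v = [y. (x, y) \<leftarrow> edges, x = v] @ [x. (x, y) \<leftarrow> edges, y = v]"

definition prism_graph :: "nat pair_pre_digraph" where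
  "prism_graph = \<lparr> pverts = {0..<34}, parcs = set edges \<union> (set edges)\<inverse> \<rparr>"

lemma parcs_prism_graph: "(u, v) \<in> parcs prism_graph \<longleftrightarrow> v \<in> set (nbrs u)"
  by (force simp: prism_graph_def nbrs_def)

lemma pverts_prism_graph [simp]: "pverts prism_graph = set [0..<34]"
  by (simp add: prism_graph_def)

lemma nbrs_subset: "v \<in> set [0..<34]" if "v \<in> set (nbrs u)"
proof -
  have "\<forall>(x, y) \<in> set edges. x < 34 \<and> y < 34"
    by code_simp
  then show ?thesis
    using that by (auto simp: nbrs_def)
qed

lemma nbrs_sym: "v \<in> set (nbrs u) \<longleftrightarrow> u \<in> set (nbrs v)"
  by (auto simp: nbrs_def)

lemma pair_graph_prism_graph: "pair_graph prism_graph"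
proof
  fix e assume "e \<in> parcs prism_graph"
  moreover obtain u v where "e = (u, v)"
    by (cases e)
  moreover have "\<forall>(x, y) \<in> set edges. x \<noteq> y"
    by code_simp
  ultimately show "fst e \<in> pverts prism_graph" "snd e \<in> pverts prism_graph" "fst e \<noteq> snd e"
    using nbrs_subset[of v u] nbrs_subset[of u v] nbrs_sym[of u v]
    by (auto simp: parcs_prism_graph) (auto simp: nbrs_def)
next
  show "finite (pverts prism_graph)" "finite (parcs prism_graph)"
    by (simp_all add: prism_graph_def)
  show "symmetric (with_proj prism_graph)"
    unfolding symmetric_def sym_def using nbrs_sym by (simp add: parcs_prism_graph)
qed

interpretation prism: pair_graph prism_graph
  by (rule pair_graph_prism_graph)

lemma cubic_prism_graph: "cubic prism_graph"
proof -
  have "\<forall>v \<in> set [0..<34]. distinct (nbrs v) \<and> length (nbrs v) = 3"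
    by code_simp
  moreover have "out_degree (with_proj prism_graph) v = card (set (nbrs v))" for v
  proof -
    have "out_arcs (with_proj prism_graph) v = Pair v ` set (nbrs v)"
      by (auto simp: out_arcs_def parcs_prism_graph)
    then show ?thesis
      by (simp add: out_degree_def card_image inj_on_def)
  qed
  ultimately show ?thesis
    by (simp add: cubic_def distinct_card)
qed

text \<open>Distances from vertex 0, serving as a certificate of connectedness that can be checked
  by evaluation.\<close>

definition distance :: "nat list" where
  "distance = [0, 1, 2, 2, 2, 1, 1, 3, 3, 3, 4, 3, 4, 3, 2, 4, 2,
     4, 4, 4, 3, 5, 5, 5, 3, 5, 3, 2, 4, 4, 4, 4, 4, 4]"

lemma connected_prism_graph: "connected (with_proj prism_graph)"
proof -
  have closer: "\<forall>v \<in> set [1..<34]. \<exists>u \<in> set (nbrs v). distance ! u < distance ! v"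
    by code_simp
  have "0 \<rightarrow>\<^sup>*\<^bsub>with_proj prism_graph\<^esub> v" if "v \<in> pverts prism_graph" for v
    using that
  proof (induction "distance ! v" arbitrary: v rule: less_induct)
    case less
    show ?case
    proof (cases "v = 0")
      case True
      then show ?thesis
        using less.prems by simp
    next
      case False
      then have "v \<in> set [1..<34]"
        using less.prems by simp
      then obtain u where u: "u \<in> set (nbrs v)" "distance ! u < distance ! v"
        using closer by blast
      then have "0 \<rightarrow>\<^sup>*\<^bsub>with_proj prism_graph\<^esub> u"
        using less.hyps nbrs_subset by simp
      moreover have "(u, v) \<in> parcs prism_graph"
        using u(1) nbrs_sym by (simp add: parcs_prism_graph)
      ultimately show ?thesis
        using prism.reachable_adj_trans by simp
    qed
  qed
  then have "u \<rightarrow>\<^sup>*\<^bsub>with_proj prism_graph\<^esub> v"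
    if "u \<in> pverts prism_graph" "v \<in> pverts prism_graph" for u v
    using that prism.symmetric_reachable' prism.reachable_trans by blast
  \<comment> \<open>\<open>connected\<close> means strong connectivity of the symmetric
    closure.\<close>
  then have "u \<rightarrow>\<^sup>*\<^bsub>with_proj (mk_symmetric (with_proj prism_graph))\<^esub> v"
    if "u \<in> pverts prism_graph" "v \<in> pverts prism_graph" for u v
    using that by (intro prism.reachable_mk_symmetricI)
  moreover have "pverts (mk_symmetric (with_proj prism_graph)) = pverts prism_graph"
    by (simp add: mk_symmetric_def)
  moreover have "pverts prism_graph \<noteq> {}"
    by simp
  ultimately show ?thesis
    by (simp only: connected_def strongly_connected_def with_proj_simps) blast
qed

lemma contains_3_cycle_prism_graph: "contains_3_cycle prism_graph"
  unfolding contains_3_cycle_def prism.cycle_def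
proof (intro exI conjI)
  have "(1, 2) \<in> set edges" "(2, 3) \<in> set edges" "(1, 3) \<in> set edges"
    by code_simp+
  then show "prism.awalk 1 [(1, 2), (2, 3), (3, 1)] 1"
    by (auto simp: prism.awalk_def) (auto simp: prism_graph_def)
qed auto

lemma no_coupon_coloring_prism_graph: "\<not> coupon_coloring 2 prism_graph c"
proof
  assume c: "coupon_coloring 2 prism_graph c"
  define b where "b v \<longleftrightarrow> c v = 1" for v
  have nae: "\<not> (b x = b y \<and> b x = b z)" if "v < 34" "set (nbrs v) = {x, y, z}" for v x y z
  proof -
    have "open_neighborhood prism_graph v = {x, y, z}"
      using that nbrs_subset by (auto simp: open_neighborhood_def parcs_prism_graph)
    moreover have "\<forall>i \<in> {0..<2}. \<exists>u \<in> open_neighborhood prism_graph v. c u = i"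
      using c \<open>v < 34\<close> by (simp add: coupon_coloring_def)
    ultimately have "\<forall>i \<in> {0..<2}. \<exists>u \<in> {x, y, z}. c u = i"
      by simp
    from bspec[OF this, of 0] bspec[OF this, of 1] show ?thesis
      by (auto simp: b_def)
  qed
  have gadget: "b (a + 7) = (\<not> b u) \<and> b a = (\<not> b v)"
    if "(a, u, v) \<in> {(6, 0, 4), (20, 2, 5)}" for a u v
  proof -
    \<comment> \<open>The neighborhoods are written in the shape that \<open>fano_negation\<close>
      expects: point -i lies on the lines -i, -(i+1), -(i+3) mod 7. The ends \<open>a\<close> and
      \<open>a + 7\<close> are L and P.\<close>
    have "\<forall>(a, u, v) \<in> {(6, 0, 4), (20, 2, 5)}.
        (\<forall>i \<in> {1, 2, 3, 4, 5, 6}.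
          a + i < 34 \<and> set (nbrs (a + i)) =
            {a + 7 + i, a + 7 + (i + 1) mod 7, a + 7 + (i + 3) mod 7} \<and>
          a + 7 + (7 - i) mod 7 < 34 \<and> set (nbrs (a + 7 + (7 - i) mod 7)) =
            {a + (7 - i) mod 7, a + (7 - (i + 1) mod 7) mod 7, a + (7 - (i + 3) mod 7) mod 7}) \<and>
        a + 7 < 34 \<and> set (nbrs a) = {u, a + 7 + 1, a + 7 + 3} \<and>
        set (nbrs (a + 7)) = {v, a + (7 - 1) mod 7, a + (7 - 3) mod 7}"
      by code_simp
    from bspec[OF this that]
    have lines: "\<forall>i \<in> {1, 2, 3, 4, 5, 6}. a + i < 34 \<and> set (nbrs (a + i)) =
            {a + 7 + i, a + 7 + (i + 1) mod 7, a + 7 + (i + 3) mod 7}"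
      and points: "\<forall>i \<in> {1, 2, 3, 4, 5, 6}.
          a + 7 + (7 - i) mod 7 < 34 \<and> set (nbrs (a + 7 + (7 - i) mod 7)) =
            {a + (7 - i) mod 7, a + (7 - (i + 1) mod 7) mod 7, a + (7 - (i + 3) mod 7) mod 7}"
      and ends: "a + 7 < 34" "set (nbrs a) = {u, a + 7 + 1, a + 7 + 3}"
        "set (nbrs (a + 7)) = {v, a + (7 - 1) mod 7, a + (7 - 3) mod 7}"
      unfolding prod.case by blast+
    have "b (a + 7 + 0) = (\<not> b u)"
    proof (rule fano_negation[where p = "\<lambda>i. b (a + 7 + i)"])
      show "\<forall>i \<in> {1, 2, 3, 4, 5, 6}. \<not> (b (a + 7 + i) = b (a + 7 + (i + 1) mod 7) \<and>
          b (a + 7 + i) = b (a + 7 + (i + 3) mod 7))"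
        using lines nae by blast
      show "\<not> (b u = b (a + 7 + 1) \<and> b u = b (a + 7 + 3))"
        using nae[OF _ ends(2)] ends(1) by linarith
    qed
    \<comment> \<open>The negation \<open>i \<mapsto> - i\<close> mod 7 of the indices is a duality between points and lines.\<close>
    moreover have "b (a + (7 - 0) mod 7) = (\<not> b v)"
    proof (rule fano_negation[where p = "\<lambda>i. b (a + (7 - i) mod 7)"])
      show "\<forall>i \<in> {1, 2, 3, 4, 5, 6}.
          \<not> (b (a + (7 - i) mod 7) = b (a + (7 - (i + 1) mod 7) mod 7) \<and>
            b (a + (7 - i) mod 7) = b (a + (7 - (i + 3) mod 7) mod 7))"
        using points nae by blast
      show "\<not> (b v = b (a + (7 - 1) mod 7) \<and> b v = b (a + (7 - 3) mod 7))"
        using nae[OF ends(1,3)] .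
    qed
    ultimately show ?thesis
      by simp
  qed
  have "b 13 = (\<not> b 0)" "b 6 = (\<not> b 4)" "b 27 = (\<not> b 2)" "b 20 = (\<not> b 5)"
    using gadget[of 6 0 4] gadget[of 20 2 5] by simp_all
  moreover have "set (nbrs 0) = {1, 5, 6}" "set (nbrs 1) = {0, 2, 3}" "set (nbrs 2) = {1, 3, 20}"
    "set (nbrs 3) = {1, 2, 4}" "set (nbrs 4) = {3, 5, 13}" "set (nbrs 5) = {0, 4, 27}"
    by code_simp+
  note this[THEN nae[rotated]]
  \<comment> \<open>With the inverted colors substituted, \<open>b 1 = b 2\<close> forces the
    remaining prism colors and leaves the neighborhood of 5 monochromatic. If
    \<open>b 1 \<noteq> b 2\<close>, either value of \<open>b 3\<close> does the same to the
    neighborhood of 4.\<close>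
  ultimately show False
    by (simp del: One_nat_def) argo
qed

theorem theorem1:
  shows "\<exists>G :: nat pair_pre_digraph.
    pair_graph G \<and> connected (with_proj G) \<and> cubic G \<and> contains_3_cycle G \<and>
    \<not> (\<exists>c. coupon_coloring 2 G c)"
  using pair_graph_prism_graph connected_prism_graph cubic_prism_graph
    contains_3_cycle_prism_graph no_coupon_coloring_prism_graph by blast

end
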